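(* Let $M$ be a compact oriented immersed hypersurface of $\mathbb{CP}^{3}$ contained in $\mathbb{CP}^{3}\setminus\mathbb{CP}^{2}$ and let $\gamma:M\to\mathbb{R}^{6}$ be the Gauss map of $M$, $\gamma(x)=\Gamma_x(\eta(x))$, where $\eta$ is a unit normal vector field along $M$. Then $\gamma(M)$ is not contained in a half-space of $\mathbb{R}^{6}$, that is, in a connected component of $\mathbb{R}^6\setminus P$ for a hyperplane $P$ through the origin.
   Context: $\mathbb{S}^7$ is the unit sphere of $\mathbb{R}^8$ identified with the octonions, with multiplication $\cdot$, unit $1=e_0$ and canonical basis $e_0,e_1,\dots,e_7$ (orthonormal, $e_1,\dots,e_7$ imaginary units, e.g. $e_m\cdot e_{m+1}=e_{m+3}$ with indices mod $7$); $i=e_1$, $e^{i\theta}=\cos\theta+(\sin\theta)\, i$. The circle acts on $\mathbb{S}^7$ by $x\mapsto e^{i\theta}\cdot x$; $\mathbb{CP}^3=\mathbb{S}^7/\mathbb{S}^1$ with projection $\pi$ carries the Fubini-Study metric making $\pi$ a Riemannian submersion. $\mathbb{CP}^2\subset\mathbb{CP}^3$ is the cut locus of $\pi(1)$, i.e. the image under $\pi$ of the points of $\mathbb{S}^7$ whose $e_0$- and $e_1$-coordinates vanish. For $v\in T_1\mathbb{S}^7$ let $$W_v(x)=\tfrac12\left(x\cdot v-i\cdot((i\cdot x)\cdot v)\right),\quad x\in\mathbb{S}^7,$$ a vector field on $\mathbb{S}^7$ satisfying $W_v(e^{i\phi}\cdot x)=e^{i\phi}\cdot W_v(x)$. It therefore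 induces vector fields on $\mathbb{CP}^3$: $Z_n(z)=d\pi_x(W_{e_{n+1}}(x))$ for any $x\in\pi^{-1}(z)$, $1\le n\le 6$. Define $\Gamma_z(w)=\left(\langle w,Z_1(z)\rangle,\dots,\langle w,Z_6(z)\rangle\right)\in\mathbb{R}^6$ for $z\in\mathbb{CP}^3\setminus\mathbb{CP}^2$, $w\in T_z\mathbb{CP}^3$. Compact hypersurfaces are without boundary (and nonempty). *)

theory Defs
  imports "HOL-Analysis.Analysis"
begin

section \<open>Smooth manifolds\<close>

text \<open>Only used for open \<open>S\<close>.\<close>

primrec Ck_on :: "nat \<Rightarrow> 'a::euclidean_space set \<Rightarrow> ('a \<Rightarrow> 'b::euclidean_space) \<Rightarrow> bool" where
  "Ck_on 0 S f \<longleftrightarrow> continuous_on S f"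
| "Ck_on (Suc k) S f \<longleftrightarrow> (\<forall>x\<in>S. f differentiable (at x)) \<and>
     (\<forall>v. Ck_on k S (\<lambda>x. frechet_derivative f (at x) v))"

definition smooth_on :: "'a::euclidean_space set \<Rightarrow> ('a \<Rightarrow> 'b::euclidean_space) \<Rightarrow> bool" where
  "smooth_on S f \<longleftrightarrow> (\<forall>k. Ck_on k S f)"

text \<open>A chart is a pair of its domain and its coordinate map.\<close>

type_synonym ('a, 'e) chart = "'a set \<times> ('a \<Rightarrow> 'e)"

definition is_chart :: "'a topology \<Rightarrow> ('a, 'e::euclidean_space) chart \<Rightarrow> bool" where
  "is_chart X c \<longleftrightarrow> openin X (fst c) \<and> open (snd c ` fst c) \<and>
     homeomorphic_map (subtopology X (fst c)) (top_of_set (snd c ` fst c)) (snd c)"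

definition chart_inv :: "('a, 'e) chart \<Rightarrow> 'e \<Rightarrow> 'a" where
  "chart_inv c = inv_into (fst c) (snd c)"

definition transition :: "('a, 'e) chart \<Rightarrow> ('a, 'e) chart \<Rightarrow> 'e \<Rightarrow> 'e" where
  "transition c d = snd d \<circ> chart_inv c"

definition smooth_manifold :: "'a topology \<Rightarrow> ('a, 'e::euclidean_space) chart set \<Rightarrow> bool" where
  "smooth_manifold X A \<longleftrightarrow> Hausdorff_space X \<and> second_countable X \<and>
     (\<forall>c\<in>A. is_chart X c) \<and> (\<Union>c\<in>A. fst c) = topspace X \<and>
     (\<forall>c\<in>A. \<forall>d\<in>A. smooth_on (snd c ` (fst c \<inter> fst d)) (transition c d))"

definition oriented_atlas :: "('a, real ^ 'n) chart set \<Rightarrow> bool" where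
  "oriented_atlas A \<longleftrightarrow> (\<forall>c\<in>A. \<forall>d\<in>A. \<forall>y \<in> snd c ` (fst c \<inter> fst d).
     det (matrix (frechet_derivative (transition c d) (at y))) > 0)"

definition smooth_map :: "'a topology \<Rightarrow> ('a, 'e::euclidean_space) chart set \<Rightarrow>
    'b topology \<Rightarrow> ('b, 'f::euclidean_space) chart set \<Rightarrow> ('a \<Rightarrow> 'b) \<Rightarrow> bool" where
  "smooth_map X A Y B f \<longleftrightarrow> continuous_map X Y f \<and>
     (\<forall>c\<in>A. \<forall>d\<in>B. smooth_on (snd c ` (fst c \<inter> f -` fst d)) (snd d \<circ> f \<circ> chart_inv c))"

text \<open>A tangent vector at \<open>p\<close> is the family of its coordinate vectors in all charts of the atlas
  around \<open>p\<close>, related by the derivatives of the transition maps. The value at anything that is not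
  a chart around \<open>p\<close> is fixed to be \<open>0\<close>.\<close>

type_synonym ('a, 'e) tvec = "('a, 'e) chart \<Rightarrow> 'e"

definition tangent_space ::
    "('a, 'e::euclidean_space) chart set \<Rightarrow> 'a \<Rightarrow> ('a, 'e) tvec set" where
  "tangent_space A p = {v.
     (\<forall>c. \<not> (c \<in> A \<and> p \<in> fst c) \<longrightarrow> v c = 0) \<and>
     (\<forall>c\<in>A. \<forall>d\<in>A. p \<in> fst c \<inter> fst d \<longrightarrow>
        v d = frechet_derivative (transition c d) (at (snd c p)) (v c))}"

text \<open>The differential of \<open>f\<close> at \<open>p\<close>; it does not depend on the chart chosen around \<open>p\<close>.\<close>

definition differential :: "('a, 'e::euclidean_space) chart set \<Rightarrow>
    ('b, 'f::euclidean_space) chart set \<Rightarrow> ('a \<Rightarrow> 'b) \<Rightarrow> 'a \<Rightarrow> ('a, 'e) tvec \<Rightarrow> ('b, 'f) tvec" where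
  "differential A B f p v =
     (let c = (SOME c. c \<in> A \<and> p \<in> fst c)
      in (\<lambda>d. if d \<in> B \<and> f p \<in> fst d
              then frechet_derivative (snd d \<circ> f \<circ> chart_inv c) (at (snd c p)) (v c) else 0))"

definition immersion :: "'a topology \<Rightarrow> ('a, 'e::euclidean_space) chart set \<Rightarrow>
    'b topology \<Rightarrow> ('b, 'f::euclidean_space) chart set \<Rightarrow> ('a \<Rightarrow> 'b) \<Rightarrow> bool" where
  "immersion X A Y B f \<longleftrightarrow> smooth_map X A Y B f \<and>
     (\<forall>p\<in>topspace X. inj_on (differential A B f p) (tangent_space A p))"

text \<open>Smooth vector fields along a map \<open>f\<close>.\<close>

definition vector_field_along :: "'a topology \<Rightarrow> ('a, 'e::euclidean_space) chart set \<Rightarrow>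
    ('b, 'f::euclidean_space) chart set \<Rightarrow> ('a \<Rightarrow> 'b) \<Rightarrow> ('a \<Rightarrow> ('b, 'f) tvec) \<Rightarrow> bool" where
  "vector_field_along X A B f \<eta> \<longleftrightarrow>
     (\<forall>p\<in>topspace X. \<eta> p \<in> tangent_space B (f p)) \<and>
     (\<forall>c\<in>A. \<forall>d\<in>B. smooth_on (snd c ` (fst c \<inter> f -` fst d)) (\<lambda>y. \<eta> (chart_inv c y) d))"


section \<open>Octonions\<close>

text \<open>An octonion is a pair of its real part and its imaginary part, whose coordinates with respect
  to \<open>e\<^sub>1, \<dots>, e\<^sub>7\<close> are indexed by the ring \<open>7\<close> of integers modulo 7; so \<open>e\<^sub>7\<close> has index \<open>0\<close>.
  The norm and inner product of this product type are those of Euclidean 8-space.\<close>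

type_synonym octo = "real \<times> (real ^ 7)"

definition octo_e :: "nat \<Rightarrow> octo" where
  "octo_e m = (if m = 0 then (1, 0) else (0, axis (of_nat m) 1))"

text \<open>The three brackets collect the products \<open>\<plusminus>e\<^sub>k\<close> coming from the cyclic permutations of
  \<open>e\<^sub>m \<cdot> e\<^bsub>m+1\<^esub> = e\<^bsub>m+3\<^esub>\<close> with \<open>m = k\<close>, \<open>m = k - 1\<close> and \<open>m = k - 3\<close> respectively.\<close>

definition octo_mult :: "octo \<Rightarrow> octo \<Rightarrow> octo"  (infixl "\<odot>" 70) where
  "x \<odot> y = (let a = fst x; u = snd x; b = fst y; v = snd y in
     (a * b - u \<bullet> v,
      \<chi> k. a * v $ k + b * u $ k
          + (u $ (k + 1) * v $ (k + 3) - u $ (k + 3) * v $ (k + 1))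
          + (u $ (k + 2) * v $ (k - 1) - u $ (k - 1) * v $ (k + 2))
          + (u $ (k - 3) * v $ (k - 2) - u $ (k - 2) * v $ (k - 3))))"

definition octo_i :: octo where
  "octo_i = octo_e 1"

definition octo_cis :: "real \<Rightarrow> octo" where
  "octo_cis \<theta> = cos \<theta> *\<^sub>R octo_e 0 + sin \<theta> *\<^sub>R octo_i"

definition S7 :: "octo set" where
  "S7 = sphere 0 1"


section \<open>The complex projective space\<close>

text \<open>Points of the complex projective space are the circle orbits in \<open>S7\<close>, with the quotient
  topology.\<close>

type_synonym cpoint = "octo set"

definition hopf :: "octo \<Rightarrow> cpoint" where
  "hopf x = {octo_cis \<theta> \<odot> x | \<theta>. True}"

definition CP3 :: "cpoint topology" where
  "CP3 = topology (\<lambda>U. U \<subseteq> hopf ` S7 \<and> openin (top_of_set S7) {x \<in> S7. hopf x \<in> U})"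

lemma openin_CP3:
  "openin CP3 U \<longleftrightarrow> U \<subseteq> hopf ` S7 \<and> openin (top_of_set S7) {x \<in> S7. hopf x \<in> U}"
proof -
  have "istopology (\<lambda>U. U \<subseteq> hopf ` S7 \<and> openin (top_of_set S7) {x \<in> S7. hopf x \<in> U})"
    unfolding istopology_def
  proof (intro conjI allI impI)
    fix S T assume "S \<subseteq> hopf ` S7 \<and> openin (top_of_set S7) {x \<in> S7. hopf x \<in> S}"
      "T \<subseteq> hopf ` S7 \<and> openin (top_of_set S7) {x \<in> S7. hopf x \<in> T}"
    moreover have "{x \<in> S7. hopf x \<in> S \<inter> T} = {x \<in> S7. hopf x \<in> S} \<inter> {x \<in> S7. hopf x \<in> T}"
      by auto
    ultimately show "S \<inter> T \<subseteq> hopf ` S7" "openin (top_of_set S7) {x \<in> S7. hopf x \<in> S \<inter> T}"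
      by (auto intro: openin_Int)
  next
    fix \<K> assume K: "\<forall>K\<in>\<K>. K \<subseteq> hopf ` S7 \<and> openin (top_of_set S7) {x \<in> S7. hopf x \<in> K}"
    have "{x \<in> S7. hopf x \<in> \<Union>\<K>} = (\<Union>K\<in>\<K>. {x \<in> S7. hopf x \<in> K})"
      by auto
    then show "openin (top_of_set S7) {x \<in> S7. hopf x \<in> \<Union>\<K>}"
      using K by (auto intro!: openin_Union )
    show "\<Union>\<K> \<subseteq> hopf ` S7"
      using K by blast
  qed
  then show ?thesis
    by (simp add: CP3_def topology_inverse')
qed

text \<open>For the complex structure given by left multiplication by \<open>i\<close>, the octonions have the complex
  basis \<open>e\<^sub>0, e\<^sub>2, e\<^sub>3, e\<^sub>5\<close>, since \<open>i \<cdot> e\<^sub>2 = e\<^sub>4\<close>, \<open>i \<cdot> e\<^sub>3 = e\<^sub>7\<close> and \<open>i \<cdot> e\<^sub>5 = e\<^sub>6\<close>. The homogeneous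
  coordinates are the coordinates in this basis, indexed modulo 4.\<close>

definition cbasis :: "nat \<Rightarrow> octo" where
  "cbasis j = octo_e ([0, 2, 3, 5] ! (j mod 4))"

definition hcoord :: "nat \<Rightarrow> octo \<Rightarrow> complex" where
  "hcoord j x = Complex (x \<bullet> cbasis j) (x \<bullet> (octo_i \<odot> cbasis j))"

text \<open>The standard affine charts.\<close>

definition affine_chart :: "nat \<Rightarrow> (cpoint, complex \<times> complex \<times> complex) chart" where
  "affine_chart j =
     (hopf ` {x \<in> S7. hcoord j x \<noteq> 0},
      \<lambda>z. let x = (SOME x. x \<in> z) in
        (hcoord (j + 1) x / hcoord j x, hcoord (j + 2) x / hcoord j x, hcoord (j + 3) x / hcoord j x))"

definition CP3_atlas :: "(cpoint, complex \<times> complex \<times> complex) chart set" where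
  "CP3_atlas = affine_chart ` {..<4}"

type_synonym cp_tvec = "(cpoint, complex \<times> complex \<times> complex) tvec"

definition CP2 :: "cpoint set" where
  "CP2 = hopf ` {x \<in> S7. x \<bullet> octo_e 0 = 0 \<and> x \<bullet> octo_e 1 = 0}"

text \<open>The differential at \<open>x \<in> S7\<close> of the projection \<open>hopf\<close> from \<open>S7\<close>, applied to a vector \<open>u\<close>
  tangent to \<open>S7\<close>, i.e. orthogonal to \<open>x\<close>. It is computed after extending \<open>hopf\<close> radially to the
  nonzero octonions.\<close>

definition hopf_diff :: "octo \<Rightarrow> octo \<Rightarrow> cp_tvec" where
  "hopf_diff x u = (\<lambda>d. if d \<in> CP3_atlas \<and> hopf x \<in> fst d
     then frechet_derivative (\<lambda>y. snd d (hopf (sgn y))) (at x) u else 0)"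

text \<open>The horizontal space: the vectors tangent to \<open>S7\<close> and orthogonal to the circle orbit.\<close>

definition horizontal :: "octo \<Rightarrow> octo set" where
  "horizontal x = {u. u \<bullet> x = 0 \<and> u \<bullet> (octo_i \<odot> x) = 0}"

definition horizontal_lift :: "octo \<Rightarrow> cp_tvec \<Rightarrow> octo" where
  "horizontal_lift x w = (THE u. u \<in> horizontal x \<and> hopf_diff x u = w)"

text \<open>The Fubini-Study metric at \<open>z\<close>; it does not depend on the point chosen in the fibre \<open>z\<close>.\<close>

definition fs_inner :: "cpoint \<Rightarrow> cp_tvec \<Rightarrow> cp_tvec \<Rightarrow> real" where
  "fs_inner z w w' = (let x = (SOME x. x \<in> z) in horizontal_lift x w \<bullet> horizontal_lift x w')"


section \<open>Immersed hypersurfaces and the Gauss map\<close>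

text \<open>Compact manifolds here are without boundary: the charts have values in open subsets of
  Euclidean space.\<close>

definition compact_oriented_immersed_hypersurface ::
    "'m topology \<Rightarrow> ('m, real ^ 5) chart set \<Rightarrow> ('m \<Rightarrow> cpoint) \<Rightarrow> bool" where
  "compact_oriented_immersed_hypersurface M A f \<longleftrightarrow>
     topspace M \<noteq> {} \<and> compact_space M \<and> smooth_manifold M A \<and> oriented_atlas A \<and>
     immersion M A CP3 CP3_atlas f"

definition unit_normal_field ::
    "'m topology \<Rightarrow> ('m, real ^ 5) chart set \<Rightarrow> ('m \<Rightarrow> cpoint) \<Rightarrow> ('m \<Rightarrow> cp_tvec) \<Rightarrow> bool" where
  "unit_normal_field M A f \<eta> \<longleftrightarrow> vector_field_along M A CP3_atlas f \<eta> \<and>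
     (\<forall>p\<in>topspace M. fs_inner (f p) (\<eta> p) (\<eta> p) = 1 \<and>
        (\<forall>\<xi>\<in>tangent_space A p. fs_inner (f p) (\<eta> p) (differential A CP3_atlas f p \<xi>) = 0))"

definition W :: "octo \<Rightarrow> octo \<Rightarrow> octo" where
  "W v x = (1 / 2) *\<^sub>R (x \<odot> v - octo_i \<odot> ((octo_i \<odot> x) \<odot> v))"

text \<open>The induced field on the quotient; it does not depend on the point chosen in the fibre.\<close>

definition Z :: "nat \<Rightarrow> cpoint \<Rightarrow> cp_tvec" where
  "Z n z = (let x = (SOME x. x \<in> z) in hopf_diff x (W (octo_e (n + 1)) x))"

definition Gamma :: "cpoint \<Rightarrow> cp_tvec \<Rightarrow> real ^ 6" where
  "Gamma z w = vector (map (\<lambda>n. fs_inner z w (Z n z)) [1..<7])"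

definition gauss_map :: "('m \<Rightarrow> cpoint) \<Rightarrow> ('m \<Rightarrow> cp_tvec) \<Rightarrow> 'm \<Rightarrow> real ^ 6" where
  "gauss_map f \<eta> p = Gamma (f p) (\<eta> p)"

text \<open>Open half-spaces bounded by a hyperplane through the origin.\<close>

definition half_space :: "'a::euclidean_space set \<Rightarrow> bool" where
  "half_space H \<longleftrightarrow> (\<exists>P. subspace P \<and> dim P = DIM('a) - 1 \<and> H \<in> components (UNIV - P))"

end

theory Submission
  imports Defs
begin

text \<open>The argument is a maximum principle for the Hamiltonian of a Killing field.

  Suppose that the image of the Gauss map avoids a hyperplane through the origin, with normal vector
  \<open>a\<close>, and let \<open>v = a\<^sub>1 e\<^sub>2 + \<dots> + a\<^sub>6 e\<^sub>7\<close>. By linearity \<open>\<gamma>(p) \<bullet> a\<close> is the inner product of the normal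
  \<open>\<eta>(p)\<close> with the field \<open>Z\<^sub>v\<close> on the projective space induced by \<open>W v\<close> (lemma \<open>inner_Gamma\<close>). So it
  suffices to find a point of the hypersurface at which \<open>Z\<^sub>v\<close> is zero or tangent to it.

  The map \<open>W v\<close> is complex linear for left multiplication by \<open>i\<close> and skew-symmetric, because right
  multiplication by the imaginary octonion \<open>v\<close> is skew-symmetric. Therefore \<open>Z\<^sub>v\<close> is a Killing field
  with the Hamiltonian \<open>Q(x) = \<langle>W v x, i \<cdot> x\<rangle> / \<bar>x\<bar>\<^sup>2\<close>, whose gradient is a nonzero multiple of
  \<open>i \<cdot> Z\<^sub>v\<close> (lemma \<open>hamiltonian_has_derivative\<close>). By compactness \<open>Q\<close> attains its maximum over the
  hypersurface at some \<open>p\<close>, and there the tangent space is orthogonal to \<open>i \<cdot> Z\<^sub>v\<close>. If \<open>Z\<^sub>v\<close> is not zero at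
  \<open>p\<close>, the tangent space, which has codimension 1, is exactly the orthogonal complement of \<open>i \<cdot> Z\<^sub>v\<close>
  (lemma \<open>hyperplane_in_horizontal\<close>), and this contains \<open>Z\<^sub>v\<close> because \<open>Z\<^sub>v\<close> and \<open>i \<cdot> Z\<^sub>v\<close> are orthogonal.

  The complement of \<open>CP2\<close> is the domain of the first affine chart, and the Hopf map has a section over it.
  Composing with this section, one replaces the differential of the immersion at \<open>p\<close> by the derivative
  of a map into the octonions (lemma \<open>local_lift\<close>), and all computations take place in the horizontal
  space at a point of the fibre.\<close>

section \<open>Octonions in coordinates\<close>

lemma UNIV_7: "UNIV = {0, 1, 2, 3, 4, 5, 6 :: 7}"
  by (rule card_subset_eq [symmetric]) simp_all

lemma sum_7: "sum g (UNIV :: 7 set) = g 0 + (g 1 + (g 2 + (g 3 + (g 4 + (g 5 + g 6)))))"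
  unfolding UNIV_7 by simp

lemma forall_7: "(\<forall>k::7. P k) \<longleftrightarrow> P 0 \<and> P 1 \<and> P 2 \<and> P 3 \<and> P 4 \<and> P 5 \<and> P 6"
proof -
  have "(\<forall>k::7. P k) \<longleftrightarrow> (\<forall>k\<in>UNIV. P k)" by simp
  then show ?thesis unfolding UNIV_7 by simp
qed

lemma mod_7_simps: "(7::7) = 0" "(8::7) = 1" "(9::7) = 2" "(10::7) = 3"
  "(- 1::7) = 6" "(- 2::7) = 5" "(- 3::7) = 4"
  by simp_all

lemma UNIV_6: "UNIV = {0, 1, 2, 3, 4, 5 :: 6}"
  by (rule card_subset_eq [symmetric]) simp_all

lemma bilinear_octo_mult: "bilinear octo_mult"
  by (auto simp: bilinear_def linear_iff octo_mult_def Let_def vec_eq_iff algebra_simps inner_simps)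

lemma octo_mult_left_simps:
  "(x + y) \<odot> z = x \<odot> z + y \<odot> z" "(c *\<^sub>R x) \<odot> z = c *\<^sub>R (x \<odot> z)" "(x - y) \<odot> z = x \<odot> z - y \<odot> z"
  "(- x) \<odot> z = - (x \<odot> z)"
  using bilinear_octo_mult
  by (auto simp: bilinear_ladd bilinear_lmul bilinear_lsub bilinear_lneg)

lemma octo_mult_right_simps:
  "z \<odot> (x + y) = z \<odot> x + z \<odot> y" "z \<odot> (c *\<^sub>R x) = c *\<^sub>R (z \<odot> x)" "z \<odot> (x - y) = z \<odot> x - z \<odot> y"
  "z \<odot> (- x) = - (z \<odot> x)"
  using bilinear_octo_mult
  by (auto simp: bilinear_radd bilinear_rmul bilinear_rsub bilinear_rneg)

lemma octo_e0_mult [simp]: "octo_e 0 \<odot> x = x"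
  by (simp add: octo_e_def octo_mult_def prod_eq_iff vec_eq_iff)

text \<open>Left multiplication by \<open>i\<close> exchanges, up to sign, the coordinates in each of the pairs
  \<open>(e\<^sub>0, e\<^sub>1)\<close>, \<open>(e\<^sub>2, e\<^sub>4)\<close>, \<open>(e\<^sub>3, e\<^sub>7)\<close>, \<open>(e\<^sub>5, e\<^sub>6)\<close>; the coordinate of
  \<open>e\<^sub>7\<close> has index \<open>0\<close>.\<close>

lemma octo_i_mult_coords:
  "fst (octo_i \<odot> x) = - snd x $ 1"
  "snd (octo_i \<odot> x) $ 0 = snd x $ 3" "snd (octo_i \<odot> x) $ 1 = fst x"
  "snd (octo_i \<odot> x) $ 2 = - snd x $ 4" "snd (octo_i \<odot> x) $ 3 = - snd x $ 0"
  "snd (octo_i \<odot> x) $ 4 = snd x $ 2" "snd (octo_i \<odot> x) $ 5 = - snd x $ 6"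
  "snd (octo_i \<odot> x) $ 6 = snd x $ 5"
proof -
  have axis: "axis (1::7) (1::real) $ k = (if k = 1 then 1 else 0)" for k
    by (simp add: axis_def)
  show "fst (octo_i \<odot> x) = - snd x $ 1"
    "snd (octo_i \<odot> x) $ 0 = snd x $ 3" "snd (octo_i \<odot> x) $ 1 = fst x"
    "snd (octo_i \<odot> x) $ 2 = - snd x $ 4" "snd (octo_i \<odot> x) $ 3 = - snd x $ 0"
    "snd (octo_i \<odot> x) $ 4 = snd x $ 2" "snd (octo_i \<odot> x) $ 5 = - snd x $ 6"
    "snd (octo_i \<odot> x) $ 6 = snd x $ 5"
    by (simp_all add: octo_i_def octo_e_def octo_mult_def Let_def axis inner_axis' mod_7_simps)
qed

lemma octo_eq_iff:
  fixes x y :: octo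
  shows "x = y \<longleftrightarrow> fst x = fst y \<and> (\<forall>k. snd x $ k = snd y $ k)"
  by (auto simp: prod_eq_iff vec_eq_iff)

lemma inner_octo:
  fixes x y :: octo
  shows "x \<bullet> y = fst x * fst y + (\<Sum>k\<in>UNIV. snd x $ k * snd y $ k)"
  by (cases x; cases y) (simp add: inner_vec_def)

lemma octo_i_mult_i [simp]: "octo_i \<odot> (octo_i \<odot> x) = - x"
  by (simp add: octo_eq_iff forall_7 octo_i_mult_coords)

lemma inner_octo_i_skew: "(octo_i \<odot> x) \<bullet> y = - (x \<bullet> (octo_i \<odot> y))"
  by (simp add: inner_octo sum_7 octo_i_mult_coords)

text \<open>For imaginary \<open>v\<close> this says that right multiplication by \<open>v\<close> is skew-symmetric.\<close>

lemma inner_octo_mult_right: "x \<bullet> (x \<odot> v) = fst v * (x \<bullet> x)"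
  by (simp add: inner_octo sum_7 octo_mult_def Let_def mod_7_simps inner_vec_def, simp add: algebra_simps)

lemma inner_cbasis:
  "x \<bullet> cbasis 0 = fst x" "x \<bullet> (octo_i \<odot> cbasis 0) = snd x $ 1"
  "x \<bullet> cbasis 1 = snd x $ 2" "x \<bullet> (octo_i \<odot> cbasis 1) = snd x $ 4"
  "x \<bullet> cbasis 2 = snd x $ 3" "x \<bullet> (octo_i \<odot> cbasis 2) = snd x $ 0"
  "x \<bullet> cbasis 3 = snd x $ 5" "x \<bullet> (octo_i \<odot> cbasis 3) = snd x $ 6"
  by (simp_all add: inner_octo sum_7 octo_i_mult_coords cbasis_def octo_e_def axis_def)

section \<open>The complex structure and the Hopf map\<close>

lemma inner_octo_i_octo_i: "(octo_i \<odot> x) \<bullet> (octo_i \<odot> y) = x \<bullet> y"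
  by (simp add: inner_octo_i_skew)

lemma inner_octo_i_self [simp]: "x \<bullet> (octo_i \<odot> x) = 0" "(octo_i \<odot> x) \<bullet> x = 0"
  using inner_octo_i_skew[of x x] by (simp_all add: inner_commute)

text \<open>Multiplication by a complex number, for the complex structure on the octonions given by left
  multiplication by \<open>i\<close>.\<close>

definition cscale :: "complex \<Rightarrow> octo \<Rightarrow> octo" where
  "cscale l x = Re l *\<^sub>R x + Im l *\<^sub>R (octo_i \<odot> x)"

lemma octo_cis_mult: "octo_cis \<theta> \<odot> x = cscale (cis \<theta>) x"
  by (simp add: octo_cis_def cscale_def octo_mult_left_simps)

lemma cscale_cscale: "cscale l (cscale m x) = cscale (l * m) x"
  by (simp add: cscale_def octo_mult_right_simps algebra_simps)

lemma cscale_of_real: "cscale (of_real r) x = r *\<^sub>R x"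
  by (simp add: cscale_def)

lemma inner_cscale: "cscale l x \<bullet> cscale l y = (cmod l)\<^sup>2 * (x \<bullet> y)"
  unfolding cmod_power2
  by (simp add: cscale_def inner_simps inner_octo_i_octo_i inner_octo_i_skew power2_eq_square algebra_simps)

lemma norm_cscale: "norm (cscale l x) = cmod l * norm x"
  by (simp add: norm_eq_sqrt_inner inner_cscale real_sqrt_mult)

lemma hcoord_add: "hcoord k (x + y) = hcoord k x + hcoord k y"
  and hcoord_scaleR: "hcoord k (r *\<^sub>R x) = r *\<^sub>R hcoord k x"
  by (simp_all add: hcoord_def complex_eq_iff inner_simps)

lemma bounded_linear_hcoord: "bounded_linear (hcoord k)"
  unfolding linear_conv_bounded_linear [symmetric] by (simp add: linear_iff hcoord_add hcoord_scaleR)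

lemma hcoord_octo_i: "hcoord k (octo_i \<odot> x) = \<i> * hcoord k x"
  by (simp add: hcoord_def complex_eq_iff inner_octo_i_skew)

lemma hcoord_cscale: "hcoord k (cscale l x) = l * hcoord k x"
  by (simp add: cscale_def hcoord_add hcoord_scaleR hcoord_octo_i complex_eq_iff)

lemma hcoord_coords:
  "hcoord 0 x = Complex (fst x) (snd x $ 1)" "hcoord 1 x = Complex (snd x $ 2) (snd x $ 4)"
  "hcoord 2 x = Complex (snd x $ 3) (snd x $ 0)" "hcoord 3 x = Complex (snd x $ 5) (snd x $ 6)"
  unfolding hcoord_def by (simp_all only: inner_cbasis)

lemma hcoord_eqI:
  assumes "hcoord 0 x = hcoord 0 y" "hcoord 1 x = hcoord 1 y" "hcoord 2 x = hcoord 2 y"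
    "hcoord 3 x = hcoord 3 y"
  shows "x = y"
  using assms unfolding hcoord_coords by (simp add: octo_eq_iff forall_7)

lemma S7_iff: "x \<in> S7 \<longleftrightarrow> norm x = 1"
  by (simp add: S7_def)

lemma hopf_cscale: "hopf x = {cscale (cis \<theta>) x | \<theta>. True}"
  by (simp add: hopf_def octo_cis_mult)

lemma mem_hopf_self: "x \<in> hopf x"
  unfolding hopf_cscale using cscale_of_real[of 1 x] by (force intro: exI[of _ 0])

lemma hopf_eq:
  assumes "y \<in> hopf x"
  shows "hopf y = hopf x"
proof -
  obtain \<phi> where y: "y = cscale (cis \<phi>) x"
    using assms by (auto simp: hopf_cscale)
  have "cscale (cis \<theta>) x = cscale (cis (\<theta> - \<phi>)) y" "cscale (cis \<theta>) y = cscale (cis (\<theta> + \<phi>)) x" for \<theta>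
    by (simp_all add: y cscale_cscale cis_mult)
  then show ?thesis
    unfolding hopf_cscale by blast
qed

lemma hopf_sgn_cscale:
  assumes "l \<noteq> 0"
  shows "hopf (sgn (cscale l x)) = hopf (sgn x)"
proof -
  have sgn: "sgn y = cscale (of_real (1 / norm y)) y" for y
    by (simp only: cscale_of_real) (simp add: sgn_div_norm divide_inverse)
  have "sgn (cscale l x) = cscale (sgn l) (sgn x)"
    unfolding sgn cscale_cscale norm_cscale by (simp add: sgn_div_norm scaleR_conv_of_real field_simps)
  also have "\<dots> = cscale (cis (Arg l)) (sgn x)"
    using assms by (simp add: cis_Arg)
  finally show ?thesis
    by (intro hopf_eq) (auto simp: hopf_cscale)
qed

text \<open>The affine coordinates of \<open>hopf x\<close> as a rational function of an arbitrary, not necessarily unit,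
  vector \<open>x\<close> on the complex line. Being defined on an open set of octonions it can be differentiated
  directly.\<close>

definition affine_coord :: "nat \<Rightarrow> octo \<Rightarrow> complex \<times> complex \<times> complex" where
  "affine_coord j x =
     (hcoord (j + 1) x / hcoord j x, hcoord (j + 2) x / hcoord j x, hcoord (j + 3) x / hcoord j x)"

lemma affine_coord_cscale: "l \<noteq> 0 \<Longrightarrow> affine_coord j (cscale l x) = affine_coord j x"
  by (simp add: affine_coord_def hcoord_cscale)

lemma hopf_in_affine_chart:
  assumes "x \<in> S7"
  shows "hopf x \<in> fst (affine_chart j) \<longleftrightarrow> hcoord j x \<noteq> 0"
proof
  assume "hopf x \<in> fst (affine_chart j)"
  then obtain y where "hcoord j y \<noteq> 0" "hopf y = hopf x"
    by (auto simp: affine_chart_def)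
  then obtain \<theta> where "y = cscale (cis \<theta>) x"
    using mem_hopf_self[of y] by (auto simp: hopf_cscale[of x])
  with \<open>hcoord j y \<noteq> 0\<close> show "hcoord j x \<noteq> 0"
    by (auto simp: hcoord_cscale)
qed (use assms in \<open>auto simp: affine_chart_def\<close>)

lemma some_in_hopf:
  obtains \<theta> where "(SOME y. y \<in> hopf x) = cscale (cis \<theta>) x"
proof -
  have "(SOME y. y \<in> hopf x) \<in> hopf x"
    by (rule someI) (rule mem_hopf_self)
  then show thesis
    using that by (auto simp: hopf_cscale)
qed

lemma affine_chart_hopf: "snd (affine_chart j) (hopf x) = affine_coord j x"
proof -
  obtain \<theta> where \<theta>: "(SOME y. y \<in> hopf x) = cscale (cis \<theta>) x"
    by (rule some_in_hopf)
  have "snd (affine_chart j) (hopf x) = affine_coord j (SOME y. y \<in> hopf x)"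
    by (simp add: affine_chart_def affine_coord_def Let_def)
  then show ?thesis
    by (simp add: \<theta> affine_coord_cscale)
qed

lemma affine_chart_hopf_sgn:
  assumes "x \<noteq> 0"
  shows "snd (affine_chart j) (hopf (sgn x)) = affine_coord j x"
proof -
  have "sgn x = cscale (of_real (1 / norm x)) x"
    by (simp only: cscale_of_real) (simp add: sgn_div_norm divide_inverse)
  then show ?thesis
    using assms by (simp add: affine_chart_hopf affine_coord_cscale)
qed

lemma affine_coord_has_derivative:
  assumes "hcoord j x \<noteq> 0"
  shows "(affine_coord j has_derivative
    (\<lambda>u. let q = (\<lambda>k. (hcoord k u * hcoord j x - hcoord k x * hcoord j u) / (hcoord j x * hcoord j x))
         in (q (j + 1), q (j + 2), q (j + 3)))) (at x)"
proof -
  have "((\<lambda>y. hcoord k y / hcoord j y) has_derivative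
     (\<lambda>u. (hcoord k u * hcoord j x - hcoord k x * hcoord j u) / (hcoord j x * hcoord j x))) (at x)" for k
    by (rule has_derivative_divide'[where g = "hcoord j"])
       (auto intro!: bounded_linear_imp_has_derivative bounded_linear_hcoord simp: assms)
  then show ?thesis
    unfolding affine_coord_def[abs_def] Let_def by (intro has_derivative_Pair)
qed

lemma affine_chart_hopf_sgn_has_derivative:
  assumes "hcoord j x \<noteq> 0"
  shows "((\<lambda>y. snd (affine_chart j) (hopf (sgn y))) has_derivative
    (\<lambda>u. let q = (\<lambda>k. (hcoord k u * hcoord j x - hcoord k x * hcoord j u) / (hcoord j x * hcoord j x))
         in (q (j + 1), q (j + 2), q (j + 3)))) (at x)"
proof (rule has_derivative_transform_within_open[OF affine_coord_has_derivative[OF assms]])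
  show "open (- {0 :: octo})" "x \<in> - {0}"
    using assms by (auto simp: hcoord_def complex_eq_iff)
qed (simp add: affine_chart_hopf_sgn)

section \<open>The differential of the Hopf map and horizontal lifts\<close>

lemma hopf_diff_has_derivative:
  assumes "d \<in> CP3_atlas" "x \<in> S7" "hopf x \<in> fst d"
  shows "((\<lambda>y. snd d (hopf (sgn y))) has_derivative (\<lambda>u. hopf_diff x u d)) (at x)"
proof -
  obtain j where "d = affine_chart j"
    using assms(1) by (auto simp: CP3_atlas_def)
  then obtain D where D: "((\<lambda>y. snd d (hopf (sgn y))) has_derivative D) (at x)"
    using affine_chart_hopf_sgn_has_derivative hopf_in_affine_chart assms by blast
  have "(\<lambda>u. hopf_diff x u d) = D"
    using frechet_derivative_at[OF D] assms by (simp add: hopf_diff_def)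
  with D show ?thesis
    by simp
qed

lemma hopf_diff_affine_chart:
  assumes "x \<in> S7" "hcoord j x \<noteq> 0" "j < 4"
  shows "hopf_diff x u (affine_chart j) =
    (let q = (\<lambda>k. (hcoord k u * hcoord j x - hcoord k x * hcoord j u) / (hcoord j x * hcoord j x))
     in (q (j + 1), q (j + 2), q (j + 3)))"
proof -
  have "affine_chart j \<in> CP3_atlas" "hopf x \<in> fst (affine_chart j)"
    using assms by (auto simp: CP3_atlas_def hopf_in_affine_chart)
  then show ?thesis
    by (simp add: hopf_diff_def
        frechet_derivative_at[OF affine_chart_hopf_sgn_has_derivative[OF assms(2)], symmetric])
qed

lemma hopf_diff_outside: "\<not> (d \<in> CP3_atlas \<and> hopf x \<in> fst d) \<Longrightarrow> hopf_diff x u d = 0"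
  by (auto simp: hopf_diff_def)

text \<open>For unit \<open>x\<close>, the orthogonal projection of the octonions onto \<open>horizontal x\<close>; its kernel is the
  complex line through \<open>x\<close>, which is also the kernel of \<open>hopf_diff x\<close>.\<close>

definition hproj :: "octo \<Rightarrow> octo \<Rightarrow> octo" where
  "hproj x u = u - (u \<bullet> x) *\<^sub>R x - (u \<bullet> (octo_i \<odot> x)) *\<^sub>R (octo_i \<odot> x)"

lemma hproj_cscale: "hproj x u = u - cscale (Complex (u \<bullet> x) (u \<bullet> (octo_i \<odot> x))) x"
  by (simp add: hproj_def cscale_def)

lemma hproj_horizontal: "x \<in> S7 \<Longrightarrow> hproj x u \<in> horizontal x"
  by (simp add: S7_iff hproj_def horizontal_def inner_simps inner_octo_i_octo_i norm_eq_1
      del: power2_norm_eq_inner)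

lemma hopf_diff_hproj:
  assumes "x \<in> S7"
  shows "hopf_diff x (hproj x u) = hopf_diff x u"
proof
  fix d
  show "hopf_diff x (hproj x u) d = hopf_diff x u d"
  proof (cases "d \<in> CP3_atlas \<and> hopf x \<in> fst d")
    case True
    then obtain j where j: "d = affine_chart j" "j < 4"
      by (auto simp: CP3_atlas_def)
    define l where "l = Complex (u \<bullet> x) (u \<bullet> (octo_i \<odot> x))"
    have h: "hcoord k (hproj x u) = hcoord k u - l * hcoord k x" for k
      using hcoord_add[of k "hproj x u" "cscale l x"] by (simp add: hproj_cscale hcoord_cscale l_def)
    have "hcoord k (hproj x u) * hcoord j x - hcoord k x * hcoord j (hproj x u)
        = hcoord k u * hcoord j x - hcoord k x * hcoord j u" for k
      by (simp add: h algebra_simps)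
    then show ?thesis
      using True j assms by (simp add: hopf_in_affine_chart hopf_diff_affine_chart)
  qed (simp add: hopf_diff_outside)
qed

lemma hopf_diff_inj:
  assumes "x \<in> S7" "hcoord 0 x \<noteq> 0" "u \<in> horizontal x" "v \<in> horizontal x"
    and "hopf_diff x u = hopf_diff x v"
  shows "u = v"
proof -
  define w where "w = u - v"
  have h: "hcoord k w = hcoord k u - hcoord k v" for k
    using hcoord_add[of k w v] by (simp add: w_def)
  define l where "l = hcoord 0 w / hcoord 0 x"
  have eq: "hcoord k u * hcoord 0 x - hcoord k x * hcoord 0 u = hcoord k v * hcoord 0 x - hcoord k x * hcoord 0 v"
    if "k \<in> {1, 2, 3}" for k
    using assms(5)[THEN fun_cong, of "affine_chart 0"] that assms(1,2)
    by (auto simp: hopf_diff_affine_chart Let_def numeral_2_eq_2)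
  have "hcoord k w = l * hcoord k x" if "k \<in> {1, 2, 3}" for k
    using eq[OF that] \<open>hcoord 0 x \<noteq> 0\<close> by (simp add: l_def h field_simps)
  moreover have "hcoord 0 w = l * hcoord 0 x"
    using \<open>hcoord 0 x \<noteq> 0\<close> by (simp add: l_def)
  ultimately have w: "w = cscale l x"
    by (intro hcoord_eqI) (simp_all add: hcoord_cscale)
  have "w \<bullet> x = 0" "w \<bullet> (octo_i \<odot> x) = 0"
    using assms(3,4) by (auto simp: w_def horizontal_def inner_simps)
  then have "w \<bullet> w = 0"
    by (subst (2) w) (simp add: cscale_def inner_simps)
  then show ?thesis
    by (simp add: w_def)
qed

lemma horizontal_lift_hopf_diff:
  assumes "x \<in> S7" "hcoord 0 x \<noteq> 0"
  shows "horizontal_lift x (hopf_diff x u) = hproj x u"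
  unfolding horizontal_lift_def
  using assms by (intro the_equality) (auto simp: hproj_horizontal hopf_diff_hproj intro: hopf_diff_inj)

text \<open>A section of the Hopf map, up to normalisation, over the first affine chart: the vector with
  homogeneous coordinates \<open>(l, l t\<^sub>1, l t\<^sub>2, l t\<^sub>3)\<close>. The factor \<open>l\<close> serves to let it pass through a
  prescribed point of a fibre.\<close>

definition affine_section :: "complex \<Rightarrow> complex \<times> complex \<times> complex \<Rightarrow> octo" where
  "affine_section l t = cscale l (cbasis 0 + (cscale (fst t) (cbasis 1)
      + cscale (fst (snd t)) (cbasis 2) + cscale (snd (snd t)) (cbasis 3)))"

lemma hcoord_cbasis:
  "hcoord 0 (cbasis 0) = 1" "hcoord 0 (cbasis 1) = 0" "hcoord 0 (cbasis 2) = 0" "hcoord 0 (cbasis 3) = 0"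
  "hcoord 1 (cbasis 0) = 0" "hcoord 1 (cbasis 1) = 1" "hcoord 1 (cbasis 2) = 0" "hcoord 1 (cbasis 3) = 0"
  "hcoord 2 (cbasis 0) = 0" "hcoord 2 (cbasis 1) = 0" "hcoord 2 (cbasis 2) = 1" "hcoord 2 (cbasis 3) = 0"
  "hcoord 3 (cbasis 0) = 0" "hcoord 3 (cbasis 1) = 0" "hcoord 3 (cbasis 2) = 0" "hcoord 3 (cbasis 3) = 1"
  unfolding hcoord_coords by (simp_all add: cbasis_def octo_e_def axis_def complex_eq_iff)

lemma hcoord_affine_section:
  "hcoord 0 (affine_section l t) = l" "hcoord 1 (affine_section l t) = l * fst t"
  "hcoord 2 (affine_section l t) = l * fst (snd t)" "hcoord 3 (affine_section l t) = l * snd (snd t)"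
  by (simp_all only: affine_section_def hcoord_cscale hcoord_add hcoord_cbasis) simp_all

lemma affine_section_affine_coord:
  assumes "hcoord 0 y \<noteq> 0"
  shows "affine_section l (affine_coord 0 y) = cscale (l / hcoord 0 y) y"
  using assms
  by (intro hcoord_eqI; simp only: hcoord_affine_section hcoord_cscale)
     (simp_all add: affine_coord_def numeral_2_eq_2 numeral_3_eq_3)

lemma affine_section_differentiable: "affine_section l differentiable (at t)"
proof -
  have cscale1: "bounded_linear (cscale l)" for l
    unfolding linear_conv_bounded_linear [symmetric]
    by (simp add: linear_iff cscale_def octo_mult_right_simps algebra_simps)
  have cscale2: "bounded_linear (\<lambda>l. cscale l y)" for y
    unfolding linear_conv_bounded_linear [symmetric]
    by (simp add: linear_iff cscale_def algebra_simps)
  have "bounded_linear (\<lambda>t. cscale l (cscale (fst t) (cbasis 1) + cscale (fst (snd t)) (cbasis 2)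
      + cscale (snd (snd t)) (cbasis 3)))" (is "bounded_linear ?L")
    by (intro bounded_linear_compose[OF cscale1] bounded_linear_add bounded_linear_compose[OF cscale2]
        bounded_linear_compose[OF bounded_linear_fst bounded_linear_snd]
        bounded_linear_compose[OF bounded_linear_snd bounded_linear_snd] bounded_linear_fst)
  then have "(\<lambda>t. cscale l (cbasis 0) + ?L t) differentiable (at t)"
    by (intro differentiable_add differentiable_const bounded_linear_imp_differentiable)
  also have "(\<lambda>t. cscale l (cbasis 0) + ?L t) = affine_section l"
    by (auto simp: affine_section_def linear_add[OF bounded_linear.linear[OF cscale1]])
  finally show ?thesis .
qed

section \<open>The fields \<open>W\<close> and their Hamiltonians\<close>

lemma W_add: "W v (x + y) = W v x + W v y"
  and W_scaleR: "W v (c *\<^sub>R x) = c *\<^sub>R W v x"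
  by (simp_all add: W_def octo_mult_left_simps octo_mult_right_simps algebra_simps)

lemma W_add_left: "W (v + w) x = W v x + W w x"
  and W_scaleR_left: "W (c *\<^sub>R v) x = c *\<^sub>R W v x"
  by (simp_all add: W_def octo_mult_left_simps octo_mult_right_simps algebra_simps)

lemma bounded_linear_W: "bounded_linear (W v)"
  unfolding linear_conv_bounded_linear [symmetric] by (simp add: linear_iff W_add W_scaleR)

lemma bounded_linear_octo_i: "bounded_linear (\<lambda>x. octo_i \<odot> x)"
  unfolding linear_conv_bounded_linear [symmetric] by (simp add: linear_iff octo_mult_right_simps)

text \<open>\<open>W v\<close> is the complex linear part of right multiplication by \<open>v\<close>.\<close>

lemma W_octo_i: "W v (octo_i \<odot> x) = octo_i \<odot> W v x"
  by (simp add: W_def octo_mult_left_simps octo_mult_right_simps)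

lemma W_cscale: "W v (cscale l x) = cscale l (W v x)"
  by (simp add: cscale_def W_add W_scaleR W_octo_i)

lemma inner_W_self:
  assumes "fst v = 0"
  shows "x \<bullet> W v x = 0"
proof -
  have "x \<bullet> (octo_i \<odot> ((octo_i \<odot> x) \<odot> v)) = - ((octo_i \<odot> x) \<bullet> ((octo_i \<odot> x) \<odot> v))"
    by (simp add: inner_octo_i_skew)
  then show ?thesis
    using assms by (simp add: W_def inner_simps inner_octo_mult_right)
qed

lemma inner_W_skew:
  assumes "fst v = 0"
  shows "W v x \<bullet> y = - (x \<bullet> W v y)"
  using inner_W_self[OF assms, of "x + y"] inner_W_self[OF assms, of x] inner_W_self[OF assms, of y]
  by (simp add: W_add inner_simps inner_commute)

text \<open>For imaginary \<open>v\<close> the field \<open>W v\<close> is skew-Hermitian and complex linear. The function below is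
  constant on complex lines, hence a function on the projective space, and up to a constant factor it
  is the Hamiltonian (the moment map) of the Killing field induced by \<open>W v\<close>.\<close>

definition hamiltonian :: "octo \<Rightarrow> octo \<Rightarrow> real" where
  "hamiltonian v x = (W v x \<bullet> (octo_i \<odot> x)) / (x \<bullet> x)"

lemma octo_i_cscale: "octo_i \<odot> cscale l x = cscale l (octo_i \<odot> x)"
  by (simp add: cscale_def octo_mult_right_simps)

lemma hamiltonian_cscale:
  assumes "l \<noteq> 0"
  shows "hamiltonian v (cscale l x) = hamiltonian v x"
  using assms by (simp add: hamiltonian_def W_cscale octo_i_cscale inner_cscale)

text \<open>The gradient of the Hamiltonian is, up to a factor, \<open>i\<close> times the horizontal part of \<open>W v\<close>. Hence
  it vanishes only where the induced field vanishes, and it is orthogonal to that field.\<close>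

lemma hamiltonian_has_derivative:
  assumes "fst v = 0" "x \<in> S7"
  shows "(hamiltonian v has_derivative (\<lambda>u. - 2 * (u \<bullet> (octo_i \<odot> hproj x (W v x))))) (at x)"
proof -
  have xx: "x \<bullet> x = 1"
    using assms(2) by (simp add: S7_iff norm_eq_1)
  have W: "(W v has_derivative W v) (at x)"
    by (intro bounded_linear_imp_has_derivative bounded_linear_W)
  have i: "((\<lambda>x. octo_i \<odot> x) has_derivative (\<lambda>x. octo_i \<odot> x)) (at x)"
    by (intro bounded_linear_imp_has_derivative bounded_linear_octo_i)
  have "(hamiltonian v has_derivative
     (\<lambda>u. ((W v x \<bullet> (octo_i \<odot> u) + W v u \<bullet> (octo_i \<odot> x)) * (x \<bullet> x)
          - (W v x \<bullet> (octo_i \<odot> x)) * (x \<bullet> u + u \<bullet> x)) / ((x \<bullet> x) * (x \<bullet> x)))) (at x)"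
    unfolding hamiltonian_def[abs_def]
    by (rule has_derivative_divide' has_derivative_inner[OF W i]
        has_derivative_inner[OF has_derivative_ident has_derivative_ident])+ (simp add: xx)
  moreover have "hproj x (W v x) = W v x - (W v x \<bullet> (octo_i \<odot> x)) *\<^sub>R (octo_i \<odot> x)"
    using inner_W_self[OF assms(1), of x] by (simp add: hproj_def inner_commute)
  then have "((W v x \<bullet> (octo_i \<odot> u) + W v u \<bullet> (octo_i \<odot> x)) * (x \<bullet> x)
          - (W v x \<bullet> (octo_i \<odot> x)) * (x \<bullet> u + u \<bullet> x)) / ((x \<bullet> x) * (x \<bullet> x))
      = - 2 * (u \<bullet> (octo_i \<odot> hproj x (W v x)))" for u
    using inner_octo_i_skew[of u "W v x"] inner_W_skew[OF assms(1), of u "octo_i \<odot> x"]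
    by (simp add: xx octo_mult_right_simps inner_simps inner_commute W_octo_i)
  ultimately show ?thesis
    by simp
qed

lemma continuous_on_hamiltonian: "continuous_on S7 (hamiltonian v)"
  unfolding hamiltonian_def[abs_def]
  by (intro continuous_on_divide continuous_on_inner continuous_on_id
      linear_continuous_on bounded_linear_W bounded_linear_octo_i) (auto simp: S7_iff)

lemma octo_i_horizontal: "u \<in> horizontal x \<Longrightarrow> octo_i \<odot> u \<in> horizontal x"
  by (auto simp: horizontal_def inner_octo_i_skew inner_octo_i_octo_i)

lemma octo_i_mult_eq_0: "octo_i \<odot> u = 0 \<longleftrightarrow> u = 0"
  by (metis inner_eq_zero_iff inner_octo_i_octo_i)

text \<open>The horizontal space has dimension 6, so that an injective linear image of dimension 5 inside the
  orthogonal complement of a nonzero horizontal vector is the whole complement.\<close>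

lemma hyperplane_in_horizontal:
  fixes L :: "real ^ 5 \<Rightarrow> octo"
  assumes x: "x \<in> S7" and g: "g \<in> horizontal x" "g \<noteq> 0"
    and L: "linear L" "inj L" "\<And>v. L v \<in> horizontal x" "\<And>v. L v \<bullet> g = 0"
    and w: "w \<in> horizontal x" "w \<bullet> g = 0"
  shows "w \<in> range L"
proof -
  define B where "B = {x, octo_i \<odot> x, g}"
  define S where "S = {y \<in> UNIV. \<forall>z \<in> span B. orthogonal z y}"
  have x0: "x \<noteq> 0" "octo_i \<odot> x \<noteq> 0"
    using x by (auto simp: S7_iff octo_i_mult_eq_0)
  have "x \<bullet> (octo_i \<odot> x) = 0" "g \<bullet> x = 0" "g \<bullet> (octo_i \<odot> x) = 0"
    using g by (auto simp: horizontal_def)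
  then have "pairwise orthogonal B"
    unfolding B_def by (intro pairwise_orthogonal_insert) (auto simp: orthogonal_def inner_commute)
  moreover have ne: "x \<noteq> octo_i \<odot> x" "x \<noteq> g" "octo_i \<odot> x \<noteq> g"
  proof -
    have "a \<noteq> b" "b \<noteq> a" if "a \<bullet> b = 0" "a \<noteq> 0" for a b :: octo
      using that by auto
    then show "x \<noteq> octo_i \<odot> x" "x \<noteq> g" "octo_i \<odot> x \<noteq> g"
      using \<open>x \<bullet> (octo_i \<odot> x) = 0\<close> \<open>g \<bullet> x = 0\<close> \<open>g \<bullet> (octo_i \<odot> x) = 0\<close> x0 g(2) by blast+
  qed
  moreover have "0 \<notin> B"
    using x0 g by (auto simp: B_def)
  ultimately have "independent B"
    by (intro pairwise_orthogonal_independent)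
  moreover have "card B = 3"
    using ne by (simp add: B_def)
  ultimately have "dim (span B) = 3"
    by (metis dim_span dim_eq_card_independent)
  then have "dim S = 5"
    using dim_subspace_orthogonal_to_vectors[of "span B" "UNIV :: octo set"]
    by (simp add: S_def)
  have S: "u \<in> S" if "u \<in> horizontal x" "u \<bullet> g = 0" for u
  proof -
    have "orthogonal u z" if "z \<in> B" for z
      using that \<open>u \<in> horizontal x\<close> \<open>u \<bullet> g = 0\<close> by (auto simp: horizontal_def B_def orthogonal_def)
    then have "orthogonal u z" if "z \<in> span B" for z
      using that by (blast intro: orthogonal_to_span)
    then show ?thesis
      by (simp add: S_def orthogonal_commute)
  qed
  have "subspace S"
    unfolding S_def by (simp add: subspace_orthogonal_to_vectors)
  moreover have "subspace (range L)" "dim (range L) = 5"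
    using L by (simp_all add: linear_subspace_image dim_image_eq)
  moreover have "range L \<subseteq> S"
    using S L by blast
  ultimately have "range L = S"
    using \<open>dim S = 5\<close> by (intro subspace_dim_equal) auto
  then show ?thesis
    using S w by blast
qed

text \<open>A vector \<open>a\<close> of 6-space corresponds to the imaginary octonion \<open>a\<^sub>1 e\<^sub>2 + \<dots> + a\<^sub>6 e\<^sub>7\<close>. The index type
  of the coordinates is the ring of integers modulo 6, so \<open>a\<^sub>6\<close> is \<open>a $ 0\<close>.\<close>

definition half_space_vector :: "real ^ 6 \<Rightarrow> octo" where
  "half_space_vector a = (\<Sum>n\<in>{1..6}. a $ of_nat n *\<^sub>R octo_e (n + 1))"

lemma Gamma_nth:
  assumes "n \<in> {1..6}"
  shows "Gamma z w $ of_nat n = fs_inner z w (Z n z)"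
proof -
  have "[1..<7] = [1, 2, 3, 4, 5, 6]"
    by (simp add: upt_rec)
  moreover have "n \<in> {1, 2, 3, 4, 5, 6}"
    using assms by auto
  ultimately show ?thesis
    by (auto simp: Gamma_def vector_def)
qed

lemma fs_inner_Z:
  assumes "x = (SOME x. x \<in> z)" "x \<in> S7" "hcoord 0 x \<noteq> 0"
  shows "fs_inner z w (Z n z) = horizontal_lift x w \<bullet> hproj x (W (octo_e (n + 1)) x)"
  using assms by (simp add: fs_inner_def Z_def Let_def horizontal_lift_hopf_diff)

lemma linear_hproj_W: "linear (\<lambda>v. hproj x (W v x))"
  by (simp add: linear_iff hproj_def W_add_left W_scaleR_left inner_simps algebra_simps)

text \<open>The right-hand side is the Fubini-Study inner product of \<open>w\<close> with the field induced by \<open>W v\<close> for the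
  octonion \<open>v\<close> that corresponds to \<open>a\<close>.\<close>

lemma inner_Gamma:
  assumes "x = (SOME x. x \<in> z)" "x \<in> S7" "hcoord 0 x \<noteq> 0"
  shows "Gamma z w \<bullet> a = horizontal_lift x w \<bullet> hproj x (W (half_space_vector a) x)"
proof -
  have "hproj x (W (half_space_vector a) x) = (\<Sum>n\<in>{1..6}. a $ of_nat n *\<^sub>R hproj x (W (octo_e (n + 1)) x))"
    unfolding half_space_vector_def
    by (simp add: linear_sum[OF linear_hproj_W] linear_cmul[OF linear_hproj_W])
  then have "horizontal_lift x w \<bullet> hproj x (W (half_space_vector a) x)
      = (\<Sum>n\<in>{1..6}. Gamma z w $ of_nat n * a $ of_nat n)"
    using assms by (simp add: inner_sum_right Gamma_nth fs_inner_Z mult.commute)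
  also have "\<dots> = (\<Sum>i\<in>UNIV. Gamma z w $ i * a $ i)"
  proof -
    have eq: "{1..6} = {1, 2, 3, 4, 5, 6 :: nat}" and mod: "(6 :: 6) = 0"
      by auto
    show ?thesis
      unfolding eq UNIV_6 by (simp add: mod)
  qed
  finally show ?thesis
    by (simp add: inner_vec_def)
qed

lemma fst_half_space_vector: "fst (half_space_vector a) = 0"
  by (simp add: half_space_vector_def fst_sum octo_e_def)

lemma half_space_normal:
  fixes H :: "(real ^ 'n) set"
  assumes "half_space H"
  obtains a where "\<And>y. y \<in> H \<Longrightarrow> y \<bullet> a \<noteq> 0"
proof -
  obtain P where P: "subspace P" "dim P = DIM(real ^ 'n) - 1" "H \<in> components (UNIV - P)"
    using assms by (auto simp: half_space_def)
  have "dim P < DIM(real ^ 'n)"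
    using P(2) by (simp add: Suc_le_eq)
  then obtain a :: "real ^ 'n" where a: "a \<noteq> 0" "span P \<subseteq> {y. a \<bullet> y = 0}"
    using lowdim_subset_hyperplane by blast
  then have "P \<subseteq> {y. a \<bullet> y = 0}"
    using span_superset by blast
  then have "P = {y. a \<bullet> y = 0}"
    using P a by (intro subspace_dim_equal) (auto simp: dim_hyperplane subspace_hyperplane)
  moreover have "H \<subseteq> UNIV - P"
    using P(3) by (rule in_components_subset)
  ultimately show thesis
    using that[of a] by (auto simp: inner_commute)
qed

section \<open>Charts and tangent vectors\<close>

lemma smooth_on_differentiable: "smooth_on S g \<Longrightarrow> x \<in> S \<Longrightarrow> g differentiable (at x)"
  using Ck_on.simps(2)[of 0 S g] by (auto simp: smooth_on_def simp del: Ck_on.simps)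

lemma is_chart_inverse:
  assumes "is_chart X c" "p \<in> fst c"
  shows "chart_inv c (snd c p) = p"
proof -
  have "fst c \<subseteq> topspace X"
    using assms(1) by (simp add: is_chart_def openin_subset)
  then have "topspace (subtopology X (fst c)) = fst c"
    by (simp add: Int_absorb1)
  moreover have "inj_on (snd c) (topspace (subtopology X (fst c)))"
    using assms(1) unfolding is_chart_def by (blast intro: homeomorphic_imp_injective_map)
  ultimately have "inj_on (snd c) (fst c)"
    by simp
  then show ?thesis
    using assms(2) by (simp add: chart_inv_def)
qed

lemma is_chart_open_image:
  assumes "is_chart X c" "openin X U" "U \<subseteq> fst c"
  shows "open (snd c ` U)"
proof -
  have "openin (subtopology X (fst c)) U"
    using assms by (auto simp: is_chart_def openin_open_subtopology)
  then have "openin (top_of_set (snd c ` fst c)) (snd c ` U)"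
    using assms(1) homeomorphic_imp_open_map unfolding is_chart_def open_map_def by blast
  moreover have "open (snd c ` fst c)"
    using assms(1) by (simp add: is_chart_def)
  ultimately show ?thesis
    by (simp add: openin_open_eq)
qed

text \<open>A tangent vector may be prescribed arbitrarily in one chart: the chain rule for the transition maps
  makes the resulting family of coordinate vectors consistent.\<close>

lemma tangent_vector_exists:
  fixes A :: "('a, 'e::euclidean_space) chart set" and v :: 'e
  assumes M: "smooth_manifold X A" and c: "c \<in> A" "p \<in> fst c"
  obtains \<xi> where "\<xi> \<in> tangent_space A p" "\<xi> c = v"
proof -
  have chart: "is_chart X d" if "d \<in> A" for d
    using M that by (auto simp: smooth_manifold_def)
  have opn: "open (snd d ` (fst d \<inter> fst e))" if "d \<in> A" "e \<in> A" for d e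
    using chart[OF that(1)] chart[OF that(2)] is_chart_open_image[of X d]
    by (auto simp: is_chart_def)
  have diff: "transition d e differentiable (at (snd d p))"
    if "d \<in> A" "e \<in> A" "p \<in> fst d" "p \<in> fst e" for d e
    using M that by (intro smooth_on_differentiable[of "snd d ` (fst d \<inter> fst e)"]) (auto simp: smooth_manifold_def)
  define D where "D d e = frechet_derivative (transition d e) (at (snd d p))"
    for d e :: "('a, 'e) chart"
  have D: "(transition d e has_derivative D d e) (at (snd d p))"
    if "d \<in> A" "e \<in> A" "p \<in> fst d" "p \<in> fst e" for d e
    unfolding D_def using diff[OF that] by (simp add: frechet_derivative_works)
  have cocycle: "D c e w = D d e (D c d w)"
    if de: "d \<in> A" "e \<in> A" "p \<in> fst d" "p \<in> fst e" for d e w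
  proof -
    have "transition c d (snd c p) = snd d p"
      using is_chart_inverse[OF chart c(2)] c by (simp add: transition_def)
    then have "(transition d e \<circ> transition c d has_derivative D d e \<circ> D c d) (at (snd c p))"
      using D de c by (intro diff_chain_at) auto
    then have "(transition c e has_derivative D d e \<circ> D c d) (at (snd c p))"
    proof (rule has_derivative_transform_within_open)
      show "open (snd c ` (fst c \<inter> fst d))"
        using opn de c by blast
      show "snd c p \<in> snd c ` (fst c \<inter> fst d)"
        using de c by blast
    next
      fix y assume "y \<in> snd c ` (fst c \<inter> fst d)"
      then obtain q where "y = snd c q" "q \<in> fst c" "q \<in> fst d"
        by blast
      then show "(transition d e \<circ> transition c d) y = transition c e y"
        using is_chart_inverse[OF chart, of c q] is_chart_inverse[OF chart, of d q] c de
        by (simp add: transition_def)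
    qed
    then have "D c e = D d e \<circ> D c d"
      using D[of c e] has_derivative_unique de c by blast
    then show ?thesis
      by simp
  qed
  have "((\<lambda>y. y) has_derivative D c c) (at (snd c p))"
  proof (rule has_derivative_transform_within_open)
    show "(transition c c has_derivative D c c) (at (snd c p))"
      using D c by blast
    show "open (snd c ` (fst c \<inter> fst c))" "snd c p \<in> snd c ` (fst c \<inter> fst c)"
      using opn c by blast+
  qed (use is_chart_inverse[OF chart[OF c(1)]] in \<open>auto simp: transition_def\<close>)
  then have "D c c = (\<lambda>w. w)"
    using has_derivative_unique has_derivative_ident by blast
  show thesis
  proof (rule that)
    show "(\<lambda>d. if d \<in> A \<and> p \<in> fst d then D c d v else 0) \<in> tangent_space A p"
    proof (unfold tangent_space_def D_def [symmetric], intro CollectI conjI allI ballI impI)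
      fix d e assume "d \<in> A" "e \<in> A" "p \<in> fst d \<inter> fst e"
      then show "(if e \<in> A \<and> p \<in> fst e then D c e v else 0)
          = D d e (if d \<in> A \<and> p \<in> fst d then D c d v else 0)"
        using cocycle[of d e] by simp
    qed auto
  qed (simp add: c \<open>D c c = (\<lambda>w. w)\<close>)
qed

section \<open>The Hamiltonian along the hypersurface\<close>

lemma topspace_CP3: "topspace CP3 = hopf ` S7"
proof -
  have "{x \<in> S7. hopf x \<in> hopf ` S7} = S7"
    by auto
  then have "openin CP3 (hopf ` S7)"
    by (simp add: openin_CP3)
  then show ?thesis
    using openin_CP3[of "topspace CP3"] openin_subset[of CP3 "hopf ` S7"] by auto
qed

lemma hopf_in_CP2_iff:
  assumes "x \<in> S7"
  shows "hopf x \<in> CP2 \<longleftrightarrow> hcoord 0 x = 0"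
proof -
  have eq: "y \<bullet> octo_e 0 = 0 \<and> y \<bullet> octo_e 1 = 0 \<longleftrightarrow> hcoord 0 y = 0" for y
    unfolding hcoord_coords by (cases y) (simp add: octo_e_def inner_axis complex_eq_iff)
  show ?thesis
  proof
    assume "hopf x \<in> CP2"
    then obtain y where "hopf x = hopf y" "hcoord 0 y = 0"
      unfolding CP2_def eq by blast
    then show "hcoord 0 x = 0"
      using mem_hopf_self[of x] by (auto simp: hopf_cscale[of y] hcoord_cscale)
  next
    assume "hcoord 0 x = 0"
    then show "hopf x \<in> CP2"
      using assms unfolding CP2_def eq by blast
  qed
qed

lemma representative:
  assumes "z \<in> topspace CP3 - CP2" "x = (SOME x. x \<in> z)"
  shows "x \<in> S7" "z = hopf x" "hcoord 0 x \<noteq> 0"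
proof -
  obtain y where y: "y \<in> S7" "z = hopf y"
    using assms(1) by (auto simp: topspace_CP3)
  obtain \<theta> where "(SOME x. x \<in> hopf y) = cscale (cis \<theta>) y"
    by (rule some_in_hopf)
  then have \<theta>: "x = cscale (cis \<theta>) y"
    using assms(2) y by simp
  then show "x \<in> S7"
    using y by (simp add: S7_iff norm_cscale)
  have "x \<in> hopf y"
    using \<theta> by (auto simp: hopf_cscale)
  then show "z = hopf x"
    using y hopf_eq by simp
  then show "hcoord 0 x \<noteq> 0"
    using assms(1) \<open>x \<in> S7\<close> hopf_in_CP2_iff by auto
qed

lemma hamiltonian_SOME: "hamiltonian v (SOME x. x \<in> hopf y) = hamiltonian v y"
proof -
  obtain \<theta> where "(SOME x. x \<in> hopf y) = cscale (cis \<theta>) y"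
    by (rule some_in_hopf)
  then show ?thesis
    by (simp add: hamiltonian_cscale)
qed

lemma hamiltonian_sgn: "hamiltonian v (sgn y) = hamiltonian v y"
proof (cases "y = 0")
  case False
  have "sgn y = cscale (of_real (inverse (norm y))) y"
    by (simp only: cscale_of_real sgn_div_norm)
  then show ?thesis
    using False by (simp add: hamiltonian_cscale)
qed simp

lemma continuous_map_hamiltonian:
  "continuous_map CP3 euclideanreal (\<lambda>z. hamiltonian v (SOME x. x \<in> z))"
proof (unfold continuous_map_def, intro conjI allI impI)
  fix U :: "real set" assume "openin euclidean U"
  have "{x \<in> S7. hopf x \<in> {z \<in> topspace CP3. hamiltonian v (SOME x. x \<in> z) \<in> U}}
      = S7 \<inter> hamiltonian v -` U"
    by (auto simp: topspace_CP3 hamiltonian_SOME)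
  moreover have "openin (top_of_set S7) (S7 \<inter> hamiltonian v -` U)"
    using continuous_openin_preimage_gen[OF continuous_on_hamiltonian] \<open>openin euclidean U\<close> by simp
  ultimately show "openin CP3 {z \<in> topspace CP3. hamiltonian v (SOME x. x \<in> z) \<in> U}"
    by (auto simp: openin_CP3 topspace_CP3)
qed simp

lemma compact_space_attains_sup:
  fixes g :: "'m \<Rightarrow> real"
  assumes "compact_space M" "topspace M \<noteq> {}" "continuous_map M euclideanreal g"
  obtains p where "p \<in> topspace M" "\<And>q. q \<in> topspace M \<Longrightarrow> g q \<le> g p"
proof -
  have "compact (g ` topspace M)"
    using image_compactin assms(1,3) by (fastforce simp: compact_space_def)
  then show thesis
    using compact_attains_sup[of "g ` topspace M"] assms(2) that by blast
qed

text \<open>Away from \<open>CP2\<close> the map \<open>f\<close> lifts, in a chart \<open>c\<close> around \<open>p\<close>, to a map \<open>\<sigma>\<close> into the octonions passing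
  through the chosen point \<open>x\<close> of the fibre. The chart is the one that enters the definition of
  \<open>differential\<close>, so that the differential of \<open>f\<close> at \<open>p\<close> factors through the derivative of \<open>\<sigma>\<close>.\<close>

lemma local_lift:
  assumes M: "smooth_manifold M A" and f: "smooth_map M A CP3 CP3_atlas f"
    and CP2: "f ` topspace M \<subseteq> topspace CP3 - CP2"
    and p: "p \<in> topspace M" and x: "x = (SOME x. x \<in> f p)"
  obtains c \<sigma> L where "c \<in> A" "p \<in> fst c" "open (snd c ` fst c)" "fst c \<subseteq> topspace M"
    "\<sigma> (snd c p) = x" "(\<sigma> has_derivative L) (at (snd c p))"
    "\<And>q. q \<in> fst c \<Longrightarrow> hopf (sgn (\<sigma> (snd c q))) = f q"
    "\<And>\<xi>. differential A CP3_atlas f p \<xi> = hopf_diff x (L (\<xi> c))"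
proof -
  define c where "c = (SOME c. c \<in> A \<and> p \<in> fst c)"
  have "p \<in> (\<Union>c\<in>A. fst c)"
    using M p by (simp add: smooth_manifold_def)
  then have "\<exists>c. c \<in> A \<and> p \<in> fst c"
    by blast
  then have c: "c \<in> A" "p \<in> fst c"
    using someI_ex[of "\<lambda>c. c \<in> A \<and> p \<in> fst c"] by (auto simp: c_def)
  have chart: "is_chart M c"
    using M c by (auto simp: smooth_manifold_def)
  have opn: "open (snd c ` fst c)"
    using chart by (simp add: is_chart_def)
  have sub: "fst c \<subseteq> topspace M"
    using chart openin_subset by (auto simp: is_chart_def)
  define a where "a = affine_chart 0"
  have a: "a \<in> CP3_atlas"
    by (auto simp: a_def CP3_atlas_def)
  define l where "l = hcoord 0 x"
  have x': "x \<in> S7" "f p = hopf x" "l \<noteq> 0"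
    using representative[of "f p" x] CP2 p x unfolding l_def by blast+
  define \<sigma> where "\<sigma> = affine_section l \<circ> (snd a \<circ> f \<circ> chart_inv c)"
  have inv: "chart_inv c (snd c q) = q" if "q \<in> fst c" for q
    using is_chart_inverse[OF chart that] .
  have dom: "f q \<in> fst a" and lift: "hopf (sgn (\<sigma> (snd c q))) = f q" if "q \<in> fst c" for q
  proof -
    define y where "y = (SOME y. y \<in> f q)"
    have y: "y \<in> S7" "f q = hopf y" "hcoord 0 y \<noteq> 0"
      using representative[of "f q" y] CP2 that sub y_def by blast+
    then show "f q \<in> fst a"
      by (simp add: a_def hopf_in_affine_chart)
    have "\<sigma> (snd c q) = cscale (l / hcoord 0 y) y"
      using y by (simp add: \<sigma>_def inv that a_def affine_chart_hopf affine_section_affine_coord)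
    then show "hopf (sgn (\<sigma> (snd c q))) = f q"
      using y x' by (simp add: hopf_sgn_cscale) (simp add: S7_iff sgn_div_norm)
  qed
  have \<sigma>p: "\<sigma> (snd c p) = x"
    using x' by (simp add: \<sigma>_def inv c a_def affine_chart_hopf affine_section_affine_coord l_def cscale_def)
  have "smooth_on (snd c ` (fst c \<inter> f -` fst a)) (snd a \<circ> f \<circ> chart_inv c)"
    using f c a by (auto simp: smooth_map_def)
  then have "(snd a \<circ> f \<circ> chart_inv c) differentiable (at (snd c p))"
    by (rule smooth_on_differentiable) (use c dom in auto)
  then have "\<sigma> differentiable (at (snd c p))"
    unfolding \<sigma>_def by (intro differentiable_chain_at affine_section_differentiable)
  then obtain L where L: "(\<sigma> has_derivative L) (at (snd c p))"
    by (auto simp: differentiable_def)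
  have "differential A CP3_atlas f p \<xi> = hopf_diff x (L (\<xi> c))" for \<xi>
  proof
    fix d
    show "differential A CP3_atlas f p \<xi> d = hopf_diff x (L (\<xi> c)) d"
    proof (cases "d \<in> CP3_atlas \<and> f p \<in> fst d")
      case True
      have "((\<lambda>y. snd d (hopf (sgn y))) has_derivative (\<lambda>u. hopf_diff x u d)) (at (\<sigma> (snd c p)))"
        using True x' \<sigma>p by (simp add: hopf_diff_has_derivative)
      from diff_chain_at[OF L this]
      have D: "(snd d \<circ> f \<circ> chart_inv c has_derivative (\<lambda>u. hopf_diff x u d) \<circ> L) (at (snd c p))"
        by (rule has_derivative_transform_within_open[OF _ opn]) (use c lift inv in auto)
      then show ?thesis
        using True frechet_derivative_at[OF D, symmetric]
        by (simp add: differential_def Let_def flip: c_def)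
    next
      case False
      then show ?thesis
        using x' by (auto simp: differential_def Let_def hopf_diff_def)
    qed
  qed
  then show thesis
    using that c opn sub \<sigma>p L lift by blast
qed

theorem corollary14:
  fixes M :: "'m topology"
    and A :: "('m, real ^ 5) chart set"
    and f :: "'m \<Rightarrow> cpoint"
    and \<eta> :: "'m \<Rightarrow> cp_tvec"
  assumes "compact_oriented_immersed_hypersurface M A f"
    and "f ` topspace M \<subseteq> topspace CP3 - CP2"
    and "unit_normal_field M A f \<eta>"
  shows "\<not> (\<exists>H. half_space H \<and> gauss_map f \<eta> ` topspace M \<subseteq> H)"
proof
  assume "\<exists>H. half_space H \<and> gauss_map f \<eta> ` topspace M \<subseteq> H"
  then obtain H where H: "half_space H" "gauss_map f \<eta> ` topspace M \<subseteq> H"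
    by blast
  obtain a where a: "\<And>y. y \<in> H \<Longrightarrow> y \<bullet> a \<noteq> 0"
    using half_space_normal[OF H(1)] by blast
  define v where "v = half_space_vector a"
  have v: "fst v = 0"
    by (simp add: v_def fst_half_space_vector)
  have M: "smooth_manifold M A" "smooth_map M A CP3 CP3_atlas f" "compact_space M" "topspace M \<noteq> {}"
    and inj: "\<And>p. p \<in> topspace M \<Longrightarrow> inj_on (differential A CP3_atlas f p) (tangent_space A p)"
    using assms(1) by (auto simp: compact_oriented_immersed_hypersurface_def immersion_def)
  define h where "h z = hamiltonian v (SOME x. x \<in> z)" for z
  have "continuous_map M euclideanreal (h \<circ> f)"
    using M(2) continuous_map_hamiltonian[of v]
    by (intro continuous_map_compose) (auto simp: smooth_map_def h_def[abs_def])
  then obtain p where p: "p \<in> topspace M" "\<And>q. q \<in> topspace M \<Longrightarrow> h (f q) \<le> h (f p)"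
    using compact_space_attains_sup[OF M(3,4)] by (metis comp_apply)
  define x where "x = (SOME x. x \<in> f p)"
  have x: "x \<in> S7" "f p = hopf x" "hcoord 0 x \<noteq> 0"
    using representative[of "f p" x] assms(2) p(1) x_def by blast+
  obtain c \<sigma> L where c: "c \<in> A" "p \<in> fst c" "open (snd c ` fst c)" "fst c \<subseteq> topspace M"
    and \<sigma>: "\<sigma> (snd c p) = x" "(\<sigma> has_derivative L) (at (snd c p))"
      "\<And>q. q \<in> fst c \<Longrightarrow> hopf (sgn (\<sigma> (snd c q))) = f q"
    and L: "\<And>\<xi>. differential A CP3_atlas f p \<xi> = hopf_diff x (L (\<xi> c))"
    using local_lift[OF M(1,2) assms(2) p(1) x_def] by blast
  \<comment> \<open>the horizontal lift to \<open>x\<close> of the field induced by \<open>W v\<close>\<close>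
  define w where "w = hproj x (W v x)"
  define g where "g = octo_i \<odot> w"
  have w: "w \<in> horizontal x"
    using x by (simp add: w_def hproj_horizontal)
  then have g: "g \<in> horizontal x"
    by (simp add: g_def octo_i_horizontal)
  have Lg: "L u \<bullet> g = 0" for u
  proof -
    have h: "(hamiltonian v \<circ> \<sigma>) (snd c q) = h (f q)" if "q \<in> fst c" for q
      by (simp add: h_def hamiltonian_SOME hamiltonian_sgn flip: \<sigma>(3)[OF that])
    \<comment> \<open>\<open>g\<close> is the gradient of the Hamiltonian up to a factor, and \<open>p\<close> is a maximum.\<close>
    have D: "(hamiltonian v \<circ> \<sigma> has_derivative (\<lambda>u. - 2 * (u \<bullet> g)) \<circ> L) (at (snd c p))"
      using hamiltonian_has_derivative[OF v x(1)] \<sigma>(1,2)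
      by (intro diff_chain_at) (auto simp: g_def w_def)
    have "(\<lambda>u. - 2 * (u \<bullet> g)) \<circ> L = (\<lambda>u. 0)"
    proof (rule differential_zero_maxmin[OF _ c(3) D])
      show "snd c p \<in> snd c ` fst c"
        using c by blast
      have "(hamiltonian v \<circ> \<sigma>) y \<le> (hamiltonian v \<circ> \<sigma>) (snd c p)" if y: "y \<in> snd c ` fst c" for y
      proof -
        obtain q where "q \<in> fst c" "y = snd c q"
          using y by blast
        then show ?thesis
          using p(2)[of q] c(2,4) h by auto
      qed
      then show "(\<forall>y\<in>snd c ` fst c. (hamiltonian v \<circ> \<sigma>) y \<le> (hamiltonian v \<circ> \<sigma>) (snd c p)) \<or>
        (\<forall>y\<in>snd c ` fst c. (hamiltonian v \<circ> \<sigma>) (snd c p) \<le> (hamiltonian v \<circ> \<sigma>) y)"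
        by blast
    qed
    then show ?thesis
      by (simp add: fun_eq_iff)
  qed
  have "horizontal_lift x (\<eta> p) \<bullet> w = 0"
  proof (cases "w = 0")
    case False
    \<comment> \<open>Both \<open>w\<close> and the tangent space of the hypersurface are orthogonal to \<open>g = i \<cdot> w \<noteq> 0\<close>, and the
      latter is a hyperplane; so \<open>w\<close> is tangent to the hypersurface.\<close>
    have "w \<in> range (\<lambda>u. hproj x (L u))"
    proof (rule hyperplane_in_horizontal[OF x(1) g])
      show "g \<noteq> 0"
        using False by (simp add: g_def octo_i_mult_eq_0)
      have "linear L"
        using \<sigma>(2) by (rule has_derivative_linear)
      then show "linear (\<lambda>u. hproj x (L u))"
        by (simp add: linear_iff hproj_def inner_simps algebra_simps)
      show "inj (\<lambda>u. hproj x (L u))"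
      proof (rule injI)
        fix u u' assume "hproj x (L u) = hproj x (L u')"
        moreover obtain \<xi> \<xi>' where \<xi>: "\<xi> \<in> tangent_space A p" "\<xi> c = u"
            "\<xi>' \<in> tangent_space A p" "\<xi>' c = u'"
          using tangent_vector_exists[OF M(1) c(1,2)] by metis
        ultimately have "differential A CP3_atlas f p \<xi> = differential A CP3_atlas f p \<xi>'"
          using L x(1) by (metis hopf_diff_hproj)
        then show "u = u'"
          using inj[OF p(1)] \<xi> by (auto dest: inj_onD)
      qed
      show "hproj x (L u) \<in> horizontal x" for u
        using x(1) by (rule hproj_horizontal)
      show "hproj x (L u) \<bullet> g = 0" for u
        using Lg[of u] g by (simp add: hproj_def horizontal_def inner_simps inner_commute)
      show "w \<in> horizontal x" "w \<bullet> g = 0"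
        using w by (simp_all add: g_def)
    qed
    then obtain u where u: "w = hproj x (L u)"
      by blast
    obtain \<xi> where \<xi>: "\<xi> \<in> tangent_space A p" "\<xi> c = u"
      using tangent_vector_exists[OF M(1) c(1,2)] by metis
    have "fs_inner (f p) (\<eta> p) (differential A CP3_atlas f p \<xi>) = 0"
      using assms(3) p(1) \<xi>(1) by (auto simp: unit_normal_field_def)
    then show ?thesis
      using \<xi> u horizontal_lift_hopf_diff[OF x(1,3)]
      unfolding fs_inner_def Let_def x_def[symmetric] L by simp
  qed simp
  then have "gauss_map f \<eta> p \<bullet> a = 0"
    using inner_Gamma[OF x_def x(1,3)] by (simp add: gauss_map_def w_def v_def)
  then show False
    using a H(2) p(1) by blast
qed

end
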